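(* Let $(A,R)$ be a modified Rota-Baxter algebra of weight $\kappa\in\mathbf{k}$, and let $(M,S)$ be a bimodule over it. Then $M$ carries an $A_R$-bimodule structure with left and right $A_R$-actions $$a\,\widetilde{\cdot}\,u:=R(a)\cdot u-S(a\cdot u),\qquad u\,\widetilde{\cdot}\,a:=u\cdot R(a)-S(u\cdot a),\qquad a\in A_R,\ u\in M.$$ Denote this $A_R$-bimodule by $\widetilde M$. Moreover, the pair $(\widetilde M,S)$ is a bimodule over the modified Rota-Baxter algebra $(A_R,R)$ of weight $\kappa$.
   Context: Everything is over a field $\mathbf{k}$ of characteristic $0$; algebras are associative (not necessarily unital). A modified Rota-Baxter algebra of weight $\kappa$ is a pair $(A,R)$ of an algebra $A$ and a linear map $R:A\to A$ with $R(a)\cdot R(b)=R(R(a)\cdot b+a\cdot R(b))+\kappa\,a\cdot b$ for all $a,b\in A$. A bimodule over $(A,R)$ is a pair $(M,S)$ of an $A$-bimodule $M$ and a linear map $S:M\to M$ with $R(a)\cdot S(u)=S(R(a)\cdot u+a\cdot S(u))+\kappa\,a\cdot u$ and $S(u)\cdot R(a)=S(S(u)\cdot a+u\cdot R(a))+\kappa\,u\cdot a$ for all $a\in A$, $u\in M$. $A_R$ denotes the vector space $A$ with the associative product $a*_Rb=R(a)\cdot b+a\cdot R(b)$; $(A_R,R)$ is again a modified Rota-Baxter algebra of weight $\kappa$. *)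

theory Defs
  imports Complex_Main
begin

text \<open>
  Vector spaces are given by a scalar multiplication on a whole type, as in the locale
  \<^locale>\<open>vector_space\<close> of the library. Products and actions are explicit parameters, because the
  same underlying space has to carry several of them (for instance \<open>A\<close> and \<open>A\<^sub>R\<close>).
\<close>

locale bilinear_map =
  vs1: vector_space s1 + vs2: vector_space s2 + vs3: vector_space s3
  for s1 :: "'k::field \<Rightarrow> 'a::ab_group_add \<Rightarrow> 'a"
    and s2 :: "'k \<Rightarrow> 'b::ab_group_add \<Rightarrow> 'b"
    and s3 :: "'k \<Rightarrow> 'c::ab_group_add \<Rightarrow> 'c" +
  fixes f :: "'a \<Rightarrow> 'b \<Rightarrow> 'c"
  assumes linear_left: "Vector_Spaces.linear s1 s3 (\<lambda>x. f x y)"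
    and linear_right: "Vector_Spaces.linear s2 s3 (\<lambda>y. f x y)"

locale assoc_algebra = bilinear_map sA sA sA mul
  for sA :: "'k::field_char_0 \<Rightarrow> 'a::ab_group_add \<Rightarrow> 'a"
    and mul :: "'a \<Rightarrow> 'a \<Rightarrow> 'a" +
  assumes mul_assoc: "mul (mul a b) c = mul a (mul b c)"

locale algebra_bimodule =
  alg: assoc_algebra sA mul +
  left: bilinear_map sA sM sM lact +
  right: bilinear_map sM sA sM ract
  for sA :: "'k::field_char_0 \<Rightarrow> 'a::ab_group_add \<Rightarrow> 'a"
    and mul :: "'a \<Rightarrow> 'a \<Rightarrow> 'a"
    and sM :: "'k \<Rightarrow> 'm::ab_group_add \<Rightarrow> 'm"
    and lact :: "'a \<Rightarrow> 'm \<Rightarrow> 'm"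
    and ract :: "'m \<Rightarrow> 'a \<Rightarrow> 'm" +
  assumes lact_lact: "lact (mul a b) u = lact a (lact b u)"
    and lact_ract: "ract (lact a u) b = lact a (ract u b)"
    and ract_ract: "ract (ract u a) b = ract u (mul a b)"

locale modified_rota_baxter_algebra = assoc_algebra sA mul
  for \<kappa> :: "'k::field_char_0"
    and sA :: "'k \<Rightarrow> 'a::ab_group_add \<Rightarrow> 'a"
    and mul :: "'a \<Rightarrow> 'a \<Rightarrow> 'a"
    and R :: "'a \<Rightarrow> 'a" +
  assumes linear_R: "Vector_Spaces.linear sA sA R"
    and modified_rota_baxter:
      "mul (R a) (R b) = R (mul (R a) b + mul a (R b)) + sA \<kappa> (mul a b)"

locale modified_rota_baxter_bimodule =
  modified_rota_baxter_algebra \<kappa> sA mul R + algebra_bimodule sA mul sM lact ract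
  for \<kappa> :: "'k::field_char_0"
    and sA :: "'k \<Rightarrow> 'a::ab_group_add \<Rightarrow> 'a"
    and mul :: "'a \<Rightarrow> 'a \<Rightarrow> 'a"
    and R :: "'a \<Rightarrow> 'a"
    and sM :: "'k \<Rightarrow> 'm::ab_group_add \<Rightarrow> 'm"
    and lact :: "'a \<Rightarrow> 'm \<Rightarrow> 'm"
    and ract :: "'m \<Rightarrow> 'a \<Rightarrow> 'm"
    and S :: "'m \<Rightarrow> 'm" +
  assumes linear_S: "Vector_Spaces.linear sM sM S"
    and left_compatible:
      "lact (R a) (S u) = S (lact (R a) u + lact a (S u)) + sM \<kappa> (lact a u)"
    and right_compatible:
      "ract (S u) (R a) = S (ract (S u) a + ract u (R a)) + sM \<kappa> (ract u a)"

definition induced_mul ::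
    "('a::ab_group_add \<Rightarrow> 'a \<Rightarrow> 'a) \<Rightarrow> ('a \<Rightarrow> 'a) \<Rightarrow> 'a \<Rightarrow> 'a \<Rightarrow> 'a" where
  "induced_mul mul R a b = mul (R a) b + mul a (R b)"

definition tilde_lact ::
    "('a \<Rightarrow> 'm \<Rightarrow> 'm) \<Rightarrow> ('a \<Rightarrow> 'a) \<Rightarrow> ('m \<Rightarrow> 'm) \<Rightarrow> 'a \<Rightarrow> 'm::ab_group_add \<Rightarrow> 'm" where
  "tilde_lact lact R S a u = lact (R a) u - S (lact a u)"

definition tilde_ract ::
    "('m \<Rightarrow> 'a \<Rightarrow> 'm) \<Rightarrow> ('a \<Rightarrow> 'a) \<Rightarrow> ('m \<Rightarrow> 'm) \<Rightarrow> 'm::ab_group_add \<Rightarrow> 'a \<Rightarrow> 'm" where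
  "tilde_ract ract R S u a = ract u (R a) - S (ract u a)"

end

theory Submission
  imports Defs
begin

text \<open>
  The identity \<open>R (a *\<^sub>R b) = R a \<cdot> R b - \<kappa> a \<cdot> b\<close> gives the statements about \<open>A\<^sub>R\<close>. In the bimodule
  axioms, products such as \<open>R a \<cdot> S u\<close> are expanded by the compatibility of \<open>S\<close>; the resulting
  terms then cancel against the corrections \<open>S (a \<cdot> u)\<close> in the twisted actions. The compatibility
  of \<open>S\<close> with the twisted actions needs, besides this expansion for \<open>R a\<close> in place of \<open>a\<close>, the image
  under \<open>S\<close> of the compatibility identity itself.
\<close>

lemma vector_space_linear_iff:
  assumes "vector_space s1" "vector_space s2"
  shows "Vector_Spaces.linear s1 s2 f \<longleftrightarrow>
    (\<forall>x y. f (x + y) = f x + f y) \<and> (\<forall>c x. f (s1 c x) = s2 c (f x))"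
  using assms
  unfolding Vector_Spaces.linear_def module_hom_def module_hom_axioms_def
    module_iff_vector_space by auto

lemma (in bilinear_map) bilinear_simps:
  "f (x + x') y = f x y + f x' y" "f x (y + y') = f x y + f x y'"
  "f (x - x') y = f x y - f x' y" "f x (y - y') = f x y - f x y'"
  "f (s1 c x) y = s3 c (f x y)" "f x (s2 c y) = s3 c (f x y)"
proof -
  interpret l: Vector_Spaces.linear s1 s3 "\<lambda>x. f x y" for y by (rule linear_left)
  interpret r: Vector_Spaces.linear s2 s3 "\<lambda>y. f x y" for x by (rule linear_right)
  show "f (x + x') y = f x y + f x' y" "f x (y + y') = f x y + f x y'"
    "f (x - x') y = f x y - f x' y" "f x (y - y') = f x y - f x y'"
    "f (s1 c x) y = s3 c (f x y)" "f x (s2 c y) = s3 c (f x y)"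
    by (rule l.add r.add l.diff r.diff l.scale r.scale)+
qed

text \<open>Leaves only equations to prove, so that bilinearity of the twisted product and of both
  twisted actions becomes a matter of rewriting.\<close>

lemma bilinear_mapI:
  assumes "vector_space s1" "vector_space s2" "vector_space s3"
    and "\<And>x x' y. f (x + x') y = f x y + f x' y" "\<And>x y y'. f x (y + y') = f x y + f x y'"
    and "\<And>c x y. f (s1 c x) y = s3 c (f x y)" "\<And>c x y. f x (s2 c y) = s3 c (f x y)"
  shows "bilinear_map s1 s2 s3 f"
  using assms unfolding bilinear_map_def bilinear_map_axioms_def
  by (simp add: vector_space_linear_iff)

context modified_rota_baxter_algebra
begin

lemmas R_simps =
  module_hom.add[OF Vector_Spaces.linear.axioms(3)[OF linear_R]]
  module_hom.diff[OF Vector_Spaces.linear.axioms(3)[OF linear_R]]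
  module_hom.scale[OF Vector_Spaces.linear.axioms(3)[OF linear_R]]

lemma R_induced_mul: "R (induced_mul mul R a b) = mul (R a) (R b) - sA \<kappa> (mul a b)"
  by (simp add: induced_mul_def modified_rota_baxter)

lemma assoc_algebra_induced: "assoc_algebra sA (induced_mul mul R)"
proof -
  have bil: "bilinear_map sA sA sA (induced_mul mul R)"
    by (rule bilinear_mapI)
      (simp_all add: vs1.vector_space_axioms induced_mul_def bilinear_simps R_simps
        vs1.scale_right_distrib algebra_simps)
  have "induced_mul mul R (induced_mul mul R a b) c
      = induced_mul mul R a (induced_mul mul R b c)" for a b c
    \<comment> \<open>Only the outer products are opened: \<open>R_induced_mul\<close> must still
      meet \<open>R\<close> of an inner product. Each bracketing then yields the same term
      \<open>- sA \<kappa> (mul a (mul b c))\<close>.\<close>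
    unfolding induced_mul_def[of mul R "induced_mul mul R a b" c]
      induced_mul_def[of mul R a "induced_mul mul R b c"] R_induced_mul
    by (simp add: induced_mul_def bilinear_simps mul_assoc algebra_simps)
  with bil show ?thesis
    by (simp add: assoc_algebra_def assoc_algebra_axioms_def)
qed

lemma modified_rota_baxter_algebra_induced:
  "modified_rota_baxter_algebra \<kappa> sA (induced_mul mul R) R"
proof -
  have "induced_mul mul R (R a) (R b)
      = R (induced_mul mul R (R a) b + induced_mul mul R a (R b))
        + sA \<kappa> (induced_mul mul R a b)" for a b
    \<comment> \<open>The two values of \<open>R\<close> on the right produce the corrections
      \<open>- \<kappa> R a b\<close> and \<open>- \<kappa> a (R b)\<close>, whose sum cancels
      \<open>\<kappa>\<close> times the induced product.\<close>
    by (simp add: R_simps(1) R_induced_mul)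
      (simp add: induced_mul_def vs1.scale_right_distrib algebra_simps)
  then show ?thesis
    using assoc_algebra_induced linear_R
    by (simp add: modified_rota_baxter_algebra_def modified_rota_baxter_algebra_axioms_def)
qed

end

context modified_rota_baxter_bimodule
begin

lemmas S_simps =
  module_hom.add[OF Vector_Spaces.linear.axioms(3)[OF linear_S]]
  module_hom.diff[OF Vector_Spaces.linear.axioms(3)[OF linear_S]]
  module_hom.scale[OF Vector_Spaces.linear.axioms(3)[OF linear_S]]

text \<open>A normal form for mixed actions: products in the algebra become iterated actions, and
  left actions move outside right ones. Reversing \<open>ract_ract\<close> keeps each
  \<open>R a\<close> a separate argument, where the compatibility of \<open>S\<close> can
  apply.\<close>

lemmas action_simps = left.bilinear_simps right.bilinear_simps S_simps
  lact_lact lact_ract ract_ract[symmetric]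

lemma algebra_bimodule_tilde:
  "algebra_bimodule sA (induced_mul mul R) sM (tilde_lact lact R S) (tilde_ract ract R S)"
proof -
  have vA: "vector_space sA" and vM: "vector_space sM"
    by (rule vs1.vector_space_axioms left.vs2.vector_space_axioms)+
  have "bilinear_map sA sM sM (tilde_lact lact R S)"
    by (rule bilinear_mapI)
      (simp_all add: vA vM tilde_lact_def action_simps R_simps
        left.vs2.scale_right_diff_distrib algebra_simps)
  moreover have "bilinear_map sM sA sM (tilde_ract ract R S)"
    by (rule bilinear_mapI)
      (simp_all add: vA vM tilde_ract_def action_simps R_simps
        left.vs2.scale_right_diff_distrib algebra_simps)
  moreover have "tilde_lact lact R S (induced_mul mul R a b) u
      = tilde_lact lact R S a (tilde_lact lact R S b u)" for a b u
    unfolding tilde_lact_def R_induced_mul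
    by (simp add: induced_mul_def action_simps left_compatible algebra_simps)
  moreover have "tilde_ract ract R S (tilde_lact lact R S a u) b
      = tilde_lact lact R S a (tilde_ract ract R S u b)" for a b u
    unfolding tilde_lact_def tilde_ract_def
    \<comment> \<open>The terms \<open>S (S (a u) b)\<close> cancel on the left and
      \<open>S (a (S (u b)))\<close> on the right; both sides become \<open>(R a) u (R b) - S ((R a)
      u b) - S (a u (R b)) - \<kappa> a u b\<close>.\<close>
    by (simp add: action_simps left_compatible right_compatible algebra_simps)
  moreover have "tilde_ract ract R S (tilde_ract ract R S u a) b
      = tilde_ract ract R S u (induced_mul mul R a b)" for a b u
    unfolding tilde_ract_def R_induced_mul
    by (simp add: induced_mul_def action_simps right_compatible algebra_simps)
  ultimately show ?thesis
    using assoc_algebra_induced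
    by (simp add: algebra_bimodule_def algebra_bimodule_axioms_def)
qed

lemma tilde_left_compatible:
  "tilde_lact lact R S (R a) (S u)
    = S (tilde_lact lact R S (R a) u + tilde_lact lact R S a (S u))
      + sM \<kappa> (tilde_lact lact R S a u)"
proof -
  \<comment> \<open>The left side of the goal collapses to
    \<open>S (R (R a) u) + \<kappa> (R a) u\<close>; this identity makes the remaining terms on the
    right vanish.\<close>
  have "S (lact (R a) (S u)) = S (S (lact (R a) u + lact a (S u)) + sM \<kappa> (lact a u))"
    by (simp only: left_compatible)
  then show ?thesis
    unfolding tilde_lact_def left_compatible[of "R a" u]
    by (simp add: S_simps left.vs2.scale_right_diff_distrib algebra_simps)
qed

lemma tilde_right_compatible:
  "tilde_ract ract R S (S u) (R a)
    = S (tilde_ract ract R S (S u) a + tilde_ract ract R S u (R a))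
      + sM \<kappa> (tilde_ract ract R S u a)"
proof -
  have "S (ract (S u) (R a)) = S (S (ract (S u) a + ract u (R a)) + sM \<kappa> (ract u a))"
    by (simp only: right_compatible)
  then show ?thesis
    unfolding tilde_ract_def right_compatible[of u "R a"]
    by (simp add: S_simps left.vs2.scale_right_diff_distrib algebra_simps)
qed

lemma modified_rota_baxter_bimodule_tilde:
  "modified_rota_baxter_bimodule \<kappa> sA (induced_mul mul R) R sM
    (tilde_lact lact R S) (tilde_ract ract R S) S"
  using modified_rota_baxter_algebra_induced algebra_bimodule_tilde linear_S
    tilde_left_compatible tilde_right_compatible
  by (simp add: modified_rota_baxter_bimodule_def modified_rota_baxter_bimodule_axioms_def)

end

theorem proposition2p12:
  fixes \<kappa> :: "'k::field_char_0"
    and sA :: "'k \<Rightarrow> 'a::ab_group_add \<Rightarrow> 'a"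
    and mul :: "'a \<Rightarrow> 'a \<Rightarrow> 'a"
    and R :: "'a \<Rightarrow> 'a"
    and sM :: "'k \<Rightarrow> 'm::ab_group_add \<Rightarrow> 'm"
    and lact :: "'a \<Rightarrow> 'm \<Rightarrow> 'm"
    and ract :: "'m \<Rightarrow> 'a \<Rightarrow> 'm"
    and S :: "'m \<Rightarrow> 'm"
  assumes "modified_rota_baxter_algebra \<kappa> sA mul R"
    and "modified_rota_baxter_bimodule \<kappa> sA mul R sM lact ract S"
  shows "algebra_bimodule sA (induced_mul mul R) sM
           (tilde_lact lact R S) (tilde_ract ract R S)
       \<and> modified_rota_baxter_bimodule \<kappa> sA (induced_mul mul R) R sM
           (tilde_lact lact R S) (tilde_ract ract R S) S"
  using modified_rota_baxter_bimodule.algebra_bimodule_tilde[OF assms(2)]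
    modified_rota_baxter_bimodule.modified_rota_baxter_bimodule_tilde[OF assms(2)]
  by (rule conjI)

end
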